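(* For every $n \geq 1$ there is a Borel maximal eventually different family $\mathcal{E}_n$ which is $n$-productive but not $(n+1)$-productive.
   Context: For countable sets $A,B$ and $f,g \in {}^{A}B$ (functions from $A$ to $B$) let $E(f,g) := \{a \in A \mid f(a) = g(a)\}$; $f$ and $g$ are eventually different if $E(f,g)$ is finite. A family $\mathcal{F} \subseteq {}^{A}B$ is eventually different (ed) if its members are pairwise eventually different, and it is maximal eventually different (med) if it is maximal with respect to inclusion among ed families contained in ${}^{A}B$. For functions $f_1,\dots,f_n$ with the same domain, $(f_1\times\dots\times f_n)(a) := (f_1(a),\dots,f_n(a))$. For a family $\mathcal{F} \subseteq {}^{A}B$ and $n \geq 1$, $\mathcal{F}^n := \{f_1 \times \dots \times f_n \mid f_1,\dots,f_n \in \mathcal{F}\} \subseteq {}^{A}(B^n)$. A med family $\mathcal{F}\subseteq {}^{A}B$ is $n$-productive if $\mathcal{F}^n$ is a med family in ${}^{A}(B^n)$. By default families consist of functions from $\omega$ to $\omega$ (equivalently, from $\omega$ to any fixed countably infinite set, via a bijection with $\omega$), and "Borel" refers to the product topology on ${}^{\omega}\omega$ with $\omega$ discrete. *)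

theory Defs
  imports "HOL-Analysis.Analysis"
begin

text \<open>The set of functions from \<open>A\<close> to \<open>B\<close> is rendered as the extensional function space
  \<open>A \<rightarrow>\<^sub>E B\<close>, so that functions are determined by their values on \<open>A\<close>.\<close>

definition agreement :: "'a set \<Rightarrow> ('a \<Rightarrow> 'b) \<Rightarrow> ('a \<Rightarrow> 'b) \<Rightarrow> 'a set" where
  "agreement A f g = {a \<in> A. f a = g a}"

definition eventually_different :: "'a set \<Rightarrow> ('a \<Rightarrow> 'b) \<Rightarrow> ('a \<Rightarrow> 'b) \<Rightarrow> bool" where
  "eventually_different A f g \<longleftrightarrow> finite (agreement A f g)"

definition ed_family :: "'a set \<Rightarrow> 'b set \<Rightarrow> ('a \<Rightarrow> 'b) set \<Rightarrow> bool" where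
  "ed_family A B F \<longleftrightarrow> F \<subseteq> A \<rightarrow>\<^sub>E B \<and> pairwise (eventually_different A) F"

definition med_family :: "'a set \<Rightarrow> 'b set \<Rightarrow> ('a \<Rightarrow> 'b) set \<Rightarrow> bool" where
  "med_family A B F \<longleftrightarrow>
     ed_family A B F \<and> (\<forall>G. ed_family A B G \<longrightarrow> F \<subseteq> G \<longrightarrow> G = F)"

text \<open>An \<open>n\<close>-tuple is a list of length \<open>n\<close>; for \<open>B\<close> a set, \<open>tuples n B\<close> is the
  Cartesian power of \<open>B\<close>.\<close>

definition tuples :: "nat \<Rightarrow> 'b set \<Rightarrow> 'b list set" where
  "tuples n B = {xs. length xs = n \<and> set xs \<subseteq> B}"

definition fun_product :: "'a set \<Rightarrow> ('a \<Rightarrow> 'b) list \<Rightarrow> 'a \<Rightarrow> 'b list" where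
  "fun_product A fs = (\<lambda>a\<in>A. map (\<lambda>f. f a) fs)"

definition family_power :: "'a set \<Rightarrow> nat \<Rightarrow> ('a \<Rightarrow> 'b) set \<Rightarrow> ('a \<Rightarrow> 'b list) set" where
  "family_power A n F = fun_product A ` tuples n F"

definition productive :: "'a set \<Rightarrow> 'b set \<Rightarrow> nat \<Rightarrow> ('a \<Rightarrow> 'b) set \<Rightarrow> bool" where
  "productive A B n F \<longleftrightarrow>
     med_family A B F \<and> med_family A (tuples n B) (family_power A n F)"

end

theory Submission
  imports Defs
begin

text \<open>
  A function \<open>p :: nat \<Rightarrow> nat\<close> is read as an \<open>n\<close>-tuple of functions, the \<open>i\<close>-th being
  \<open>\<lambda>k. component i (p k)\<close>. Every such \<open>p\<close> contributes \<open>n\<close> functions \<open>member n p i\<close> to the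
  family. Outside a set \<open>support n p\<close>, the value at \<open>k\<close> of \<open>member n p i\<close> is a number
  \<open>code p i k\<close> that records \<open>i\<close> and the restriction of \<open>p\<close> to \<open>{..k}\<close>; codes of different tuples
  eventually differ. On the support, which is infinite and almost disjoint from the supports of all other tuples,
  \<open>member n p i\<close> copies the \<open>i\<close>-th function of the tuple, so that the \<open>n\<close> functions of the tuple
  are all met by the family, and at the same arguments.

  One thing can go wrong with copying: the function to be copied may itself equal codes \<open>code q j k\<close>
  (with \<open>j < n\<close>) of another tuple infinitely often, that is, it may guess \<open>q\<close>; then the copy
  and \<open>member n q j\<close> are not eventually different. By Ramsey's theorem the support can be thinned out such that, for each \<open>i\<close>, either no
  two values of the \<open>i\<close>-th function on the support are codes of one and the same \<open>q\<close> and \<open>j\<close>, or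
  any two are. In the first case copying is safe (\<open>not_guessing_finite\<close>). In the second
  case the function runs on the whole support through the codes of one \<open>q\<close> and \<open>j\<close>
  (\<open>guessing_branch\<close>); it is then not copied, and this does no harm since \<open>member n q j\<close> already
  agrees with it at all but finitely many points of the support. The family is therefore
  eventually different (\<open>ed_guess_family\<close>) and its \<open>n\<close>-th power is maximal
  (\<open>guess_family_hits\<close>).

  The power \<open>n + 1\<close> is not maximal (\<open>guess_family_avoids\<close>): codes are odd, so the constant functions
  \<open>0, 2, \<dots>, 2 * n\<close> can only be met on supports. As these are almost disjoint, infinitely many
  simultaneous agreements would have to come from the \<open>n\<close> functions of one tuple; two of the
  \<open>n + 1\<close> constants would be met by the same function at the same argument.

  The family is Borel because a homogeneous set for a colouring can be selected in a Borel way
  (\<open>measurable_hom_set\<close>), and because supports consist of odd numbers: the tuple can be read off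
  from the values of a member at even arguments, so that no projection is involved
  (\<open>borel_guess_family\<close>).
\<close>

section \<open>Borel selection of homogeneous sets\<close>

text \<open>The proof of Ramsey's theorem for pairs builds a sequence in which the colour of a pair depends
  only on its first element. A list of pairs \<open>(a, r)\<close> is a finite stage of it, latest element
  first, where \<open>r\<close> is the colour promised for all pairs starting with \<open>a\<close>. All choices below
  are least choices, and the only infinitary question asked is whether a set of numbers is
  infinite; this is what makes the outcome a Borel function of the colouring.\<close>

definition admissible :: "(nat \<Rightarrow> nat \<Rightarrow> nat) \<Rightarrow> (nat \<times> nat) list \<Rightarrow> nat \<Rightarrow> bool" where
  "admissible c st b \<longleftrightarrow> (\<forall>(a, r) \<in> set st. a < b \<and> c a b = r)"

definition next_elem :: "(nat \<Rightarrow> nat \<Rightarrow> nat) \<Rightarrow> (nat \<times> nat) list \<Rightarrow> nat" where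
  "next_elem c st = (LEAST a. admissible c st a)"

definition next_colour :: "(nat \<Rightarrow> nat \<Rightarrow> nat) \<Rightarrow> (nat \<times> nat) list \<Rightarrow> nat" where
  "next_colour c st = (LEAST r. infinite {b. admissible c ((next_elem c st, r) # st) b})"

primrec stage :: "(nat \<Rightarrow> nat \<Rightarrow> nat) \<Rightarrow> nat \<Rightarrow> (nat \<times> nat) list" where
  "stage c 0 = []"
| "stage c (Suc k) = (next_elem c (stage c k), next_colour c (stage c k)) # stage c k"

definition elem :: "(nat \<Rightarrow> nat \<Rightarrow> nat) \<Rightarrow> nat \<Rightarrow> nat" where
  "elem c k = next_elem c (stage c k)"

definition elem_colour :: "(nat \<Rightarrow> nat \<Rightarrow> nat) \<Rightarrow> nat \<Rightarrow> nat" where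
  "elem_colour c k = next_colour c (stage c k)"

definition hom_colour :: "(nat \<Rightarrow> nat \<Rightarrow> nat) \<Rightarrow> nat" where
  "hom_colour c = (LEAST r. infinite {k. elem_colour c k = r})"

definition hom_set :: "(nat \<Rightarrow> nat \<Rightarrow> nat) \<Rightarrow> nat set" where
  "hom_set c = elem c ` {k. elem_colour c k = hom_colour c}"

text \<open>The pigeonhole principle: among the infinitely many candidates above the new element, some
  colour occurs infinitely often, so the promise for it can be kept.\<close>

lemma infinite_admissible_stage:
  assumes "finite R" and c: "\<And>a b. c a b \<in> R"
  shows "infinite {b. admissible c (stage c k) b}"
proof (induction k)
  case 0
  then show ?case by (simp add: admissible_def)
next
  case (Suc k)
  let ?st = "stage c k"
  define a where "a = next_elem c ?st"
  have "infinite ({b. admissible c ?st b} - {..a})"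
    using Suc by simp
  moreover have "finite (c a ` ({b. admissible c ?st b} - {..a}))"
    using assms by (auto intro: finite_subset)
  ultimately obtain b0 where
    "infinite {b \<in> {b. admissible c ?st b} - {..a}. c a b = c a b0}"
    using pigeonhole_infinite by blast
  moreover have "{b \<in> {b. admissible c ?st b} - {..a}. c a b = c a b0}
      = {b. admissible c ((a, c a b0) # ?st) b}"
    by (auto simp: admissible_def)
  ultimately have "\<exists>r. infinite {b. admissible c ((a, r) # ?st) b}" by metis
  then have "infinite {b. admissible c ((a, next_colour c ?st) # ?st) b}"
    unfolding next_colour_def a_def by (rule LeastI_ex)
  then show ?case by (simp add: a_def)
qed

lemma elem_in_stage: "i < k \<Longrightarrow> (elem c i, elem_colour c i) \<in> set (stage c k)"
  by (induction k) (auto simp: less_Suc_eq elem_def elem_colour_def)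

lemma elem_pair:
  assumes "finite R" and "\<And>a b. c a b \<in> R" and "i < k"
  shows "elem c i < elem c k" and "c (elem c i) (elem c k) = elem_colour c i"
proof -
  have "\<exists>b. admissible c (stage c k) b"
    using infinite_admissible_stage[of R c k] assms(1,2) not_finite_existsD by blast
  then have "admissible c (stage c k) (elem c k)"
    unfolding elem_def next_elem_def by (rule LeastI_ex)
  then show "elem c i < elem c k" and "c (elem c i) (elem c k) = elem_colour c i"
    using elem_in_stage[OF \<open>i < k\<close>, of c] unfolding admissible_def by auto
qed

lemma infinite_hom_colour:
  assumes "finite R" and c: "\<And>a b. c a b \<in> R"
  shows "infinite {k. elem_colour c k = hom_colour c}"
proof -
  have "elem_colour c k \<in> R" for k
    using elem_pair(2)[of R c k "Suc k", OF assms] c by (metis lessI)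
  then have "finite (range (elem_colour c))"
    using \<open>finite R\<close> by (meson finite_subset image_subsetI)
  then have "\<exists>r. infinite {k. elem_colour c k = r}"
    using pigeonhole_infinite[of UNIV "elem_colour c"] by auto
  then show ?thesis
    unfolding hom_colour_def by (rule LeastI_ex)
qed

lemma infinite_hom_set:
  assumes "finite R" and "\<And>a b. c a b \<in> R"
  shows "infinite (hom_set c)"
proof -
  have "strict_mono (elem c)"
    using elem_pair(1)[of R c, OF assms] by (simp add: strict_mono_def)
  then have "inj_on (elem c) {k. elem_colour c k = hom_colour c}"
    by (meson inj_on_subset strict_mono_imp_inj_on subset_UNIV)
  then show ?thesis
    unfolding hom_set_def using infinite_hom_colour[of R c, OF assms] finite_imageD by blast
qed

lemma hom_set_homogeneous:
  assumes "finite R" and "\<And>a b. c a b \<in> R"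
    and "a \<in> hom_set c" "b \<in> hom_set c" "a < b"
  shows "c a b = hom_colour c"
proof -
  obtain i k where ik: "a = elem c i" "b = elem c k" "elem_colour c i = hom_colour c"
    using assms(3,4) unfolding hom_set_def by blast
  have "i < k"
    using elem_pair(1)[of R c k i, OF assms(1,2)] ik \<open>a < b\<close>
    by (metis less_asym not_less_iff_gr_or_eq)
  then show ?thesis using elem_pair(2)[of R c i k, OF assms(1,2)] ik by simp
qed

text \<open>The stages take values in a countable type. To see that a further step is measurable it is
  therefore enough to look at it for a constant stage, by \<open>measurable_compose_countable\<close>.\<close>

context
  fixes M :: "'x measure" and c :: "'x \<Rightarrow> nat \<Rightarrow> nat \<Rightarrow> nat"
  assumes c_measurable [measurable]: "\<And>a b. (\<lambda>x. c x a b) \<in> measurable M (count_space UNIV)"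
begin

lemma measurable_admissible [measurable]: "Measurable.pred M (\<lambda>x. admissible (c x) st b)"
  unfolding admissible_def case_prod_beta by measurable

lemma measurable_next_elem [measurable]:
  "(\<lambda>x. next_elem (c x) st) \<in> measurable M (count_space UNIV)"
  unfolding next_elem_def by measurable

lemma measurable_next_colour [measurable]:
  "(\<lambda>x. next_colour (c x) st) \<in> measurable M (count_space UNIV)"
proof -
  have "(\<lambda>x. LEAST r. infinite {b. admissible (c x) ((a, r) # st) b})
      \<in> measurable M (count_space UNIV)" for a
    by measurable
  then show ?thesis
    unfolding next_colour_def by (rule measurable_compose_countable) measurable
qed

lemma measurable_stage [measurable]:
  "(\<lambda>x. stage (c x) k) \<in> measurable M (count_space UNIV)"
proof (induction k)
  case 0
  then show ?case by simp
next
  case (Suc k)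
  have "(\<lambda>x. (a, r) # st) \<in> measurable M (count_space UNIV)" for a r and st :: "(nat \<times> nat) list"
    by simp
  then have "(\<lambda>x. (a, next_colour (c x) st) # st) \<in> measurable M (count_space UNIV)" for a st
    by (rule measurable_compose_countable) measurable
  then have "(\<lambda>x. (next_elem (c x) st, next_colour (c x) st) # st)
      \<in> measurable M (count_space UNIV)" for st
    by (rule measurable_compose_countable) measurable
  then show ?case
    unfolding stage.simps by (rule measurable_compose_countable) (rule Suc)
qed

lemma measurable_elem [measurable]: "(\<lambda>x. elem (c x) k) \<in> measurable M (count_space UNIV)"
  unfolding elem_def
  by (rule measurable_compose_countable[where f = "\<lambda>st x. next_elem (c x) st"]) measurable

lemma measurable_elem_colour [measurable]:
  "(\<lambda>x. elem_colour (c x) k) \<in> measurable M (count_space UNIV)"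
  unfolding elem_colour_def
  by (rule measurable_compose_countable[where f = "\<lambda>st x. next_colour (c x) st"]) measurable

lemma measurable_hom_colour: "(\<lambda>x. hom_colour (c x)) \<in> measurable M (count_space UNIV)"
  unfolding hom_colour_def by measurable

lemma measurable_hom_set: "Measurable.pred M (\<lambda>x. a \<in> hom_set (c x))"
proof -
  note measurable_hom_colour [measurable]
  \<comment> \<open>Naming the common colour reduces an equation between two measurable functions to equations
    with constants.\<close>
  have "Measurable.pred M (\<lambda>x. \<exists>k r. elem (c x) k = a \<and> elem_colour (c x) k = r \<and> hom_colour (c x) = r)"
    by measurable
  moreover have "a \<in> hom_set (c x) \<longleftrightarrow> (\<exists>k r. elem (c x) k = a \<and> elem_colour (c x) k = r \<and> hom_colour (c x) = r)"
    for x unfolding hom_set_def by auto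
  ultimately show ?thesis by simp
qed

end

section \<open>Codes of initial segments\<close>

text \<open>Iterated unpairing without a fixed depth: for every \<open>n\<close> at once, the first \<open>n\<close> components of a
  number run through all \<open>n\<close>-tuples of natural numbers.\<close>

primrec component :: "nat \<Rightarrow> nat \<Rightarrow> nat" where
  "component 0 m = fst (prod_decode m)"
| "component (Suc i) m = component i (snd (prod_decode m))"

lemma component_le: "component i m \<le> m"
proof (induction i arbitrary: m)
  case 0
  then show ?case
    by (metis component.simps(1) le_prod_encode_1 prod.collapse prod_decode_inverse)
next
  case (Suc i)
  have "snd (prod_decode m) \<le> m"
    by (metis le_prod_encode_2 prod.collapse prod_decode_inverse)
  with Suc[of "snd (prod_decode m)"] show ?case by simp
qed

lemma component_surj: "\<exists>m. \<forall>i<n. component i m = f i"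
proof (induction n arbitrary: f)
  case 0
  then show ?case by simp
next
  case (Suc n)
  from Suc[of "\<lambda>i. f (Suc i)"] obtain m where m: "\<forall>i<n. component i m = f (Suc i)"
    by (elim exE)
  have "component i (prod_encode (f 0, m)) = f i" if "i < Suc n" for i
    by (cases i) (use that m in simp_all)
  then have "\<forall>i<Suc n. component i (prod_encode (f 0, m)) = f i" by blast
  then show ?case ..
qed

text \<open>The code contains \<open>p k\<close> itself, and not only the values of \<open>p\<close> below \<open>k\<close>, so that it exceeds
  everything the tuple could ask to copy at \<open>k\<close>. Being odd, it stays clear of the even numbers, which
  serve as targets that no code can hit.\<close>

definition code :: "(nat \<Rightarrow> nat) \<Rightarrow> nat \<Rightarrow> nat \<Rightarrow> nat" where
  "code p j k = 2 * list_encode (j # map p [0..<Suc k]) + 1"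

lemma odd_code: "odd (code p j k)"
  by (simp add: code_def)

lemma code_eq_iff: "code p j k = code q l m \<longleftrightarrow> j = l \<and> k = m \<and> (\<forall>i\<le>k. p i = q i)"
proof -
  have "code p j k = code q l m \<longleftrightarrow> j = l \<and> map p [0..<Suc k] = map q [0..<Suc m]"
    by (simp add: code_def list_encode_eq del: list_encode.simps upt_Suc)
  also have "map p [0..<Suc k] = map q [0..<Suc m] \<longleftrightarrow> k = m \<and> (\<forall>i\<le>k. p i = q i)"
  proof
    assume eq: "map p [0..<Suc k] = map q [0..<Suc m]"
    from arg_cong[OF this, of length] have "k = m" by simp
    with eq show "k = m \<and> (\<forall>i\<le>k. p i = q i)"
      by (auto simp: less_Suc_eq_le simp del: upt_Suc)
  qed (auto simp del: upt_Suc)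
  finally show ?thesis .
qed

lemma list_encode_greater: "x \<in> set xs \<Longrightarrow> x < list_encode xs"
proof (induction xs)
  case (Cons y ys)
  then have "x = y \<or> x \<le> list_encode ys" by fastforce
  moreover have "y < list_encode (y # ys)" "list_encode ys < list_encode (y # ys)"
    by (simp_all add: less_Suc_eq_le le_prod_encode_1 le_prod_encode_2)
  ultimately show ?case by linarith
qed simp

text \<open>A tuple never guesses its own codes. Hence the \<open>n\<close> functions of one tuple do not meet each other
  when one copies and another one codes, and a guessed tuple is always a different one.\<close>

lemma component_less_code: "component i (p k) < code p j k"
proof -
  have "p k < list_encode (j # map p [0..<Suc k])"
    by (rule list_encode_greater) simp
  with component_le[of i "p k"] show ?thesis
    by (simp add: code_def del: list_encode.simps upt_Suc)
qed

lemma finite_code_agreement: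
  assumes "p \<noteq> q"
  shows "finite {k. code p i k = code q j k}"
proof -
  from assms obtain m where "p m \<noteq> q m" by blast
  then have "{k. code p i k = code q j k} \<subseteq> {..<m}"
    unfolding code_eq_iff using not_le by blast
  then show ?thesis by (rule finite_subset) simp
qed

definition common_code :: "nat \<Rightarrow> nat \<Rightarrow> nat \<Rightarrow> nat \<Rightarrow> nat \<Rightarrow> bool" where
  "common_code n k u l v \<longleftrightarrow> (\<exists>q j. j < n \<and> u = code q j k \<and> v = code q j l)"

text \<open>Codes of the same tuple are compatible initial segments, so pairwise compatibility
  along an infinite set of lengths glues them to one function.\<close>

lemma common_code_branch:
  assumes "infinite X" and pairs: "\<And>k l. k \<in> X \<Longrightarrow> l \<in> X \<Longrightarrow> k \<noteq> l \<Longrightarrow> common_code n k (u k) l (u l)"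
  shows "\<exists>q j. j < n \<and> (\<forall>k\<in>X. u k = code q j k)"
proof -
  have "\<exists>q j. j < n \<and> u k = code q j k" if k: "k \<in> X" for k
  proof -
    obtain l where "l \<in> X" "k < l"
      using \<open>infinite X\<close> unfolding infinite_nat_iff_unbounded by blast
    then show ?thesis using pairs[OF k, of l] unfolding common_code_def by blast
  qed
  then obtain q j where qj: "\<And>k. k \<in> X \<Longrightarrow> j k < n \<and> u k = code (q k) (j k) k"
    by metis
  have compat: "j k = j l \<and> (\<forall>i. i \<le> k \<longrightarrow> i \<le> l \<longrightarrow> q k i = q l i)" if kl: "k \<in> X" "l \<in> X" for k l
  proof (cases "k = l")
    case False
    then obtain q' j' where "u k = code q' j' k" "u l = code q' j' l"
      using pairs[OF kl] unfolding common_code_def by blast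
    then show ?thesis using qj[OF kl(1)] qj[OF kl(2)] by (auto simp: code_eq_iff)
  qed simp
  \<comment> \<open>The value of the glued function at \<open>m\<close> is read off from some segment of length at least \<open>m\<close>.\<close>
  obtain \<kappa> where \<kappa>: "\<And>m. \<kappa> m \<in> X \<and> m \<le> \<kappa> m"
    using \<open>infinite X\<close> unfolding infinite_nat_iff_unbounded_le by metis
  have "u k = code (\<lambda>m. q (\<kappa> m) m) (j (\<kappa> 0)) k" if k: "k \<in> X" for k
  proof -
    have "j k = j (\<kappa> 0)"
      using compat[OF k, of "\<kappa> 0"] \<kappa> by blast
    moreover have "q k m = q (\<kappa> m) m" if "m \<le> k" for m
      using compat[OF k, of "\<kappa> m"] \<kappa> that by blast
    ultimately show ?thesis using qj[OF k] by (simp add: code_eq_iff)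
  qed
  then show ?thesis using qj \<kappa> by blast
qed

section \<open>The family\<close>

text \<open>The candidates for the support of \<open>p\<close> are the numbers \<open>code p 0 a\<close>, that is, the nodes of the
  branch \<open>p\<close>, which makes supports almost disjoint. The pair of the candidates with indices \<open>a\<close> and
  \<open>b\<close> is coloured by the set of those \<open>i\<close> for which the \<open>i\<close>-th function guesses a common tuple at both.\<close>

definition colour :: "nat \<Rightarrow> (nat \<Rightarrow> nat) \<Rightarrow> nat \<Rightarrow> nat \<Rightarrow> nat" where
  "colour n p a b =
     (let k = code p 0 a; l = code p 0 b
      in set_encode {i. i < n \<and> common_code n k (component i (p k)) l (component i (p l))})"

definition support :: "nat \<Rightarrow> (nat \<Rightarrow> nat) \<Rightarrow> nat set" where
  "support n p = code p 0 ` hom_set (colour n p)"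

definition guessing :: "nat \<Rightarrow> (nat \<Rightarrow> nat) \<Rightarrow> nat set" where
  "guessing n p = set_decode (hom_colour (colour n p))"

lemma colour_finite_range:
  "finite (set_encode ` Pow {..<n})" "colour n p a b \<in> set_encode ` Pow {..<n}"
proof -
  show "finite (set_encode ` Pow {..<n})" by simp
  show "colour n p a b \<in> set_encode ` Pow {..<n}"
    unfolding colour_def Let_def by (rule imageI) blast
qed

lemma infinite_support: "infinite (support n p)"
proof -
  have "inj_on (code p 0) (hom_set (colour n p))"
    by (simp add: inj_on_def code_eq_iff)
  then show ?thesis
    using infinite_hom_set[of _ "colour n p", OF colour_finite_range] by (simp add: support_def finite_image_iff)
qed

lemma odd_support: "k \<in> support n p \<Longrightarrow> odd k"
  by (auto simp: support_def odd_code)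

lemma support_almost_disjoint:
  assumes "p \<noteq> q"
  shows "finite (support n p \<inter> support m q)"
proof -
  have "support n p \<inter> support m q \<subseteq> code p 0 ` {a. code p 0 a = code q 0 a}"
  proof
    fix k assume "k \<in> support n p \<inter> support m q"
    then obtain a b where k: "k = code p 0 a" "k = code q 0 b"
      unfolding support_def by blast
    then have "a = b" using code_eq_iff[of p 0 a q 0 b] by simp
    with k show "k \<in> code p 0 ` {a. code p 0 a = code q 0 a}" by blast
  qed
  then show ?thesis
    using finite_code_agreement[OF assms] by (meson finite_imageI finite_subset)
qed

lemma support_homogeneous:
  assumes "i < n" "k \<in> support n p" "l \<in> support n p" "k \<noteq> l"
  shows "common_code n k (component i (p k)) l (component i (p l)) \<longleftrightarrow> i \<in> guessing n p"
proof -
  have less: "common_code n (code p 0 a) (component i (p (code p 0 a)))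
      (code p 0 b) (component i (p (code p 0 b))) \<longleftrightarrow> i \<in> guessing n p"
    if "a \<in> hom_set (colour n p)" "b \<in> hom_set (colour n p)" "a < b" for a b
  proof -
    have "colour n p a b = hom_colour (colour n p)"
      using hom_set_homogeneous[of _ "colour n p", OF colour_finite_range that] .
    then have "guessing n p = set_decode (colour n p a b)" by (simp add: guessing_def)
    also have "\<dots> = {i. i < n \<and> common_code n (code p 0 a) (component i (p (code p 0 a)))
      (code p 0 b) (component i (p (code p 0 b)))}"
      by (simp add: colour_def Let_def)
    finally show ?thesis using \<open>i < n\<close> by simp
  qed
  have sym: "common_code n k' u l' v \<longleftrightarrow> common_code n l' v k' u" for k' u l' v
    unfolding common_code_def by blast
  obtain a b where ab: "a \<in> hom_set (colour n p)" "b \<in> hom_set (colour n p)"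
    "k = code p 0 a" "l = code p 0 b"
    using assms unfolding support_def by blast
  then have "a \<noteq> b" using assms by blast
  then consider "a < b" | "b < a" by linarith
  then show ?thesis
    using less[OF ab(1,2)] less[OF ab(2,1)] sym ab(3,4) by cases auto
qed

lemma guessing_branch:
  assumes "i < n" "i \<in> guessing n p"
  shows "\<exists>q j. j < n \<and> (\<forall>k\<in>support n p. component i (p k) = code q j k)"
proof (rule common_code_branch[where u = "\<lambda>k. component i (p k)", OF infinite_support])
  fix k l assume "k \<in> support n p" "l \<in> support n p" "k \<noteq> l"
  then show "common_code n k (component i (p k)) l (component i (p l))"
    using support_homogeneous[OF assms(1)] assms(2) by simp
qed

text \<open>Two agreements with the same code sequence would be a pair of values with a common code, which
  homogeneity excludes; so there is at most one agreement.\<close>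

lemma not_guessing_finite:
  assumes "i < n" "i \<notin> guessing n p" "j < n"
  shows "finite {k \<in> support n p. component i (p k) = code q j k}" (is "finite ?S")
proof -
  have "k = l" if kl: "k \<in> ?S" "l \<in> ?S" for k l
  proof (rule ccontr)
    assume "k \<noteq> l"
    moreover have "common_code n k (component i (p k)) l (component i (p l))"
      unfolding common_code_def using kl \<open>j < n\<close> by blast
    ultimately show False
      using support_homogeneous[OF assms(1)] kl assms(2) by blast
  qed
  then have "?S = {} \<or> (\<exists>k. ?S = {k})" by blast
  then show ?thesis by (metis finite.emptyI finite.insertI)
qed

text \<open>Two functions of a tuple may agree infinitely often. The copy is therefore left to the first
  of them, separately at each argument.\<close>

definition member :: "nat \<Rightarrow> (nat \<Rightarrow> nat) \<Rightarrow> nat \<Rightarrow> nat \<Rightarrow> nat" where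
  "member n p i k =
     (if k \<in> support n p \<and> i \<notin> guessing n p \<and> (\<forall>j<i. component j (p k) \<noteq> component i (p k))
      then component i (p k) else code p i k)"

definition guess_family :: "nat \<Rightarrow> (nat \<Rightarrow> nat) set" where
  "guess_family n = {member n p i |p i. i < n}"

lemma member_in_guess_family: "i < n \<Longrightarrow> member n p i \<in> guess_family n"
  unfolding guess_family_def by blast

lemma member_off_support: "k \<notin> support n p \<Longrightarrow> member n p i k = code p i k"
  by (simp add: member_def)

lemma member_same_tuple:
  assumes "i < j"
  shows "member n p i k \<noteq> member n p j k"
proof -
  have "code p i k \<noteq> code p j k" using assms code_eq_iff[of p i k p j k] by simp
  moreover have "component i (p k) \<noteq> code p j k" "component j (p k) \<noteq> code p i k"
    using component_less_code by (simp_all add: less_imp_neq)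
  ultimately show ?thesis using assms unfolding member_def by metis
qed

text \<open>Outside the two supports both functions take codes as values. Within one support only a copied
  value can equal a code of the other tuple, and a function that guesses is not copied.\<close>

lemma member_different_tuples:
  assumes "p \<noteq> q" "i < n" "j < n"
  shows "finite {k. member n p i k = member n q j k}"
proof -
  let ?guess = "\<lambda>p i q j. {k \<in> support n p. i \<notin> guessing n p \<and> component i (p k) = code q j k}"
  have fin: "finite (?guess p i q j)" if "i < n" "j < n" for p i q j
    by (cases "i \<in> guessing n p") (use not_guessing_finite that in auto)
  have "{k. member n p i k = member n q j k} \<subseteq>
      (support n p \<inter> support n q) \<union> {k. code p i k = code q j k} \<union> ?guess p i q j \<union> ?guess q j p i"
    by (auto simp: member_def split: if_splits)
  then show ?thesis
    by (rule finite_subset)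
      (use assms fin support_almost_disjoint finite_code_agreement in auto)
qed

lemma ed_guess_family: "ed_family UNIV UNIV (guess_family n)"
proof -
  have "finite {k. member n p i k = member n q j k}"
    if "i < n" "j < n" "member n p i \<noteq> member n q j" for p q i j
  proof (cases "p = q")
    case True
    with that have "i \<noteq> j" by blast
    then have "{k. member n p i k = member n q j k} = {}"
      using True member_same_tuple by (metis (mono_tags, lifting) empty_Collect_eq nat_neq_iff)
    then show ?thesis by simp
  next
    case False
    then show ?thesis using member_different_tuples that by blast
  qed
  then show ?thesis
    unfolding ed_family_def pairwise_def eventually_different_def agreement_def guess_family_def
    by auto
qed

text \<open>Take the tuple \<open>p\<close> with the functions \<open>h i\<close>. On an infinite part \<open>Z\<close> of its support the pattern of
  equalities among the \<open>h i\<close> is constant. There \<open>h i\<close> coincides with \<open>h m\<close>, where \<open>m\<close> is the first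
  index with an equal value; \<open>h m\<close> is either copied by \<open>member n p m\<close> or guesses another
  tuple \<open>q\<close>, whose function agrees with it outside the support of \<open>q\<close>.\<close>

lemma guess_family_hits:
  fixes h :: "nat \<Rightarrow> nat \<Rightarrow> nat"
  shows "\<exists>f. (\<forall>i<n. f i \<in> guess_family n) \<and> infinite {k. \<forall>i<n. f i k = h i k}"
proof -
  have "\<exists>m. \<forall>i<n. component i m = h i k" for k
    by (rule component_surj)
  then obtain p where p: "\<And>k i. i < n \<Longrightarrow> component i (p k) = h i k" by metis
  let ?X = "support n p"
  define first where "first k i = (LEAST j. component j (p k) = component i (p k))" for k i
  have first: "component (first k i) (p k) = component i (p k)"
    "first k i \<le> i" "j < first k i \<Longrightarrow> component j (p k) \<noteq> component i (p k)" for k i j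
    unfolding first_def by (rule LeastI, rule refl) (rule Least_le, rule refl, erule not_less_Least)
  have "finite ((\<lambda>k. map (first k) [0..<n]) ` ?X)"
  proof (rule finite_subset)
    show "(\<lambda>k. map (first k) [0..<n]) ` ?X \<subseteq> {xs. set xs \<subseteq> {..<n} \<and> length xs = n}"
      using le_less_trans[OF first(2)] by auto
    show "finite {xs. set xs \<subseteq> {..<n} \<and> length xs = n}"
      by (simp add: finite_lists_length_eq)
  qed
  then obtain k0 where inf: "infinite {k \<in> ?X. map (first k) [0..<n] = map (first k0) [0..<n]}"
    using pigeonhole_infinite[OF infinite_support[of n p]] by blast
  define Z where "Z = {k \<in> ?X. map (first k) [0..<n] = map (first k0) [0..<n]}"
  have Z: "infinite Z" "Z \<subseteq> ?X" and Z_first: "k \<in> Z \<Longrightarrow> i < n \<Longrightarrow> first k i = first k0 i" for k i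
    using inf unfolding Z_def by auto
  have "\<exists>g\<in>guess_family n. finite (Z - {k. g k = h i k})" if "i < n" for i
  proof -
    define m where "m = first k0 i"
    have "m < n" using first(2)[of k0 i] that by (simp add: m_def)
    have hm: "component m (p k) = h i k" if "k \<in> Z" for k
      using Z_first[OF that \<open>i < n\<close>] first(1)[of k i] p[OF \<open>i < n\<close>] by (simp add: m_def)
    show ?thesis
    proof (cases "m \<in> guessing n p")
      case False
      have "member n p m k = h i k" if "k \<in> Z" for k
        using False that Z hm[OF that] first(3)[of _ k i] Z_first[OF that \<open>i < n\<close>]
          p[OF \<open>i < n\<close>] by (auto simp: member_def m_def)
      then have "Z - {k. member n p m k = h i k} = {}" by blast
      then show ?thesis
        using member_in_guess_family[OF \<open>m < n\<close>] by (metis finite.emptyI)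
    next
      case True
      then obtain q j where qj: "j < n" "\<And>k. k \<in> ?X \<Longrightarrow> component m (p k) = code q j k"
        using guessing_branch \<open>m < n\<close> by blast
      obtain k1 where "k1 \<in> ?X" using infinite_imp_nonempty[OF infinite_support] by blast
      then have "p \<noteq> q"
        using qj(2) component_less_code[of m p k1 j] by auto
      have "Z - {k. member n q j k = h i k} \<subseteq> ?X \<inter> support n q"
        using Z qj(2) hm member_off_support by force
      then have "finite (Z - {k. member n q j k = h i k})"
        using support_almost_disjoint[OF \<open>p \<noteq> q\<close>] finite_subset by blast
      then show ?thesis using member_in_guess_family[OF qj(1)] by blast
    qed
  qed
  then obtain f where f: "\<And>i. i < n \<Longrightarrow> f i \<in> guess_family n \<and> finite (Z - {k. f i k = h i k})"
    by metis
  have "finite (\<Union>i<n. Z - {k. f i k = h i k})"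
    by (intro finite_UN_I) (use f in auto)
  then have "infinite (Z - (\<Union>i<n. Z - {k. f i k = h i k}))" using Z(1) by simp
  moreover have "Z - (\<Union>i<n. Z - {k. f i k = h i k}) \<subseteq> {k. \<forall>i<n. f i k = h i k}" by auto
  ultimately show ?thesis using f infinite_super by blast
qed

text \<open>A member can take an even value at \<open>k\<close> only if \<open>k\<close> lies in the support of its tuple. Almost
  disjointness of supports leaves a single tuple, which has only \<open>n\<close> functions for the \<open>n + 1\<close>
  different constants.\<close>

lemma guess_family_avoids:
  assumes f: "\<And>i. i \<le> n \<Longrightarrow> f i \<in> guess_family n"
  shows "finite {k. \<forall>i\<le>n. f i k = 2 * i}" (is "finite ?S")
proof (rule ccontr)
  assume inf: "infinite ?S"
  obtain p j where pj: "\<And>i. i \<le> n \<Longrightarrow> j i < n \<and> f i = member n (p i) (j i)"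
    using f unfolding guess_family_def mem_Collect_eq by metis
  have supp: "k \<in> support n (p i)" if "i \<le> n" "k \<in> ?S" for i k
  proof (rule ccontr)
    assume "k \<notin> support n (p i)"
    then have "2 * i = code (p i) (j i) k" using that pj[of i] member_off_support by auto
    then show False using odd_code[of "p i" "j i" k] by (metis dvd_triv_left)
  qed
  have "p i = p 0" if "i \<le> n" for i
  proof (rule ccontr)
    assume "p i \<noteq> p 0"
    moreover have "?S \<subseteq> support n (p i) \<inter> support n (p 0)" using supp that by blast
    ultimately show False using support_almost_disjoint inf finite_subset by blast
  qed
  moreover have "\<not> inj_on j {..n}"
  proof
    assume "inj_on j {..n}"
    then have "card {..n} \<le> card {..<n}"
      by (rule card_inj_on_le) (use pj in auto)
    then show False by simp
  qed
  ultimately obtain i i' where "i \<le> n" "i' \<le> n" "i \<noteq> i'" "f i = f i'"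
    using pj unfolding inj_on_def by (metis atMost_iff)
  moreover obtain k where "k \<in> ?S" using infinite_imp_nonempty[OF inf] by blast
  ultimately show False
    by (metis (mono_tags, lifting) mem_Collect_eq mult_left_cancel zero_neq_numeral)
qed

section \<open>The family is Borel\<close>

abbreviation baire :: "(nat \<Rightarrow> nat) measure" where
  "baire \<equiv> borel"

lemma measurable_eval [measurable]: "(\<lambda>p. p k) \<in> measurable baire (count_space UNIV)"
proof -
  have "(\<lambda>p. p k) \<in> borel_measurable baire" by (rule measurable_product_coordinates)
  then show ?thesis
    by (simp only: measurable_cong_sets[OF refl sets_borel_eq_count_space])
qed

lemma measurable_map_eval: "(\<lambda>p. map p xs) \<in> measurable baire (count_space UNIV)"
proof (induction xs)
  case (Cons x xs)
  have "(\<lambda>p. p x # ys) \<in> measurable baire (count_space UNIV)" for ys :: "nat list"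
    by (rule measurable_compose[OF measurable_eval]) simp
  then show ?case
    unfolding list.map by (rule measurable_compose_countable) (rule Cons)
qed simp

lemma measurable_code [measurable]: "(\<lambda>p. code p j k) \<in> measurable baire (count_space UNIV)"
  unfolding code_def by (rule measurable_compose[OF measurable_map_eval]) simp

lemma measurable_eval_code [measurable]:
  "(\<lambda>p. p (code p j k)) \<in> measurable baire (count_space UNIV)"
  by (rule measurable_compose_countable[where f = "\<lambda>k p. p k"]) measurable

lemma measurable_colour [measurable]:
  "(\<lambda>p. colour n p a b) \<in> measurable baire (count_space UNIV)"
proof -
  define F where "F k u l v =
    set_encode {i. i < n \<and> common_code n k (component i u) l (component i v)}" for k u l v
  have "(\<lambda>p. F (code p 0 a) (p (code p 0 a)) (code p 0 b) (p (code p 0 b)))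
      \<in> measurable baire (count_space UNIV)"
    by measurable
  then show ?thesis unfolding colour_def F_def Let_def .
qed

lemma measurable_support [measurable]: "Measurable.pred baire (\<lambda>p. k \<in> support n p)"
proof -
  note measurable_hom_set [measurable]
  have "Measurable.pred baire (\<lambda>p. \<exists>a. k = code p 0 a \<and> a \<in> hom_set (colour n p))"
    by measurable
  moreover have "k \<in> support n p \<longleftrightarrow> (\<exists>a. k = code p 0 a \<and> a \<in> hom_set (colour n p))" for p
    unfolding support_def by auto
  ultimately show ?thesis by simp
qed

lemma measurable_guessing [measurable]: "Measurable.pred baire (\<lambda>p. i \<in> guessing n p)"
  unfolding guessing_def
  by (rule measurable_compose[OF measurable_hom_colour[OF measurable_colour]]) simp

lemma measurable_member: "(\<lambda>p. member n p i k) \<in> measurable baire (count_space UNIV)"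
  unfolding member_def by measurable

text \<open>Position \<open>0\<close> of the coded list holds the index of the function within the tuple, so the value
  \<open>p k\<close> is at position \<open>Suc k\<close>. The argument \<open>2 * k\<close> is even, hence outside the support, and
  large enough for the code to reach \<open>k\<close>.\<close>

definition decode :: "(nat \<Rightarrow> nat) \<Rightarrow> nat \<Rightarrow> nat" where
  "decode f k = list_decode (f (2 * k) div 2) ! Suc k"

lemma decode_member: "decode (member n p i) = p"
proof
  fix k
  have "member n p i (2 * k) = code p i (2 * k)"
    by (rule member_off_support) (use odd_support in fastforce)
  then show "decode (member n p i) k = p k"
    by (simp add: decode_def code_def del: list_encode.simps upt_Suc)
qed

lemma measurable_decode: "decode \<in> measurable baire baire"
proof (rule measurable_coordinatewise_then_product)
  fix k
  have "(\<lambda>f. decode f k) \<in> measurable baire (count_space UNIV)"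
    unfolding decode_def by (rule measurable_compose[OF measurable_eval]) simp
  then show "(\<lambda>f. decode f k) \<in> borel_measurable baire"
    by (simp only: measurable_cong_sets[OF refl sets_borel_eq_count_space])
qed

text \<open>A function belongs to the family iff it equals one of the \<open>n\<close> functions built from its own
  decoding, which is a countable condition; the decoding replaces a quantifier over all tuples.\<close>

lemma borel_guess_family: "guess_family n \<in> sets borel"
proof -
  define g where "g i k f = member n (decode f) i k" for i k f
  have [measurable]: "g i k \<in> measurable baire (count_space UNIV)" for i k
    unfolding g_def by (rule measurable_compose[OF measurable_decode measurable_member])
  have "Measurable.pred baire (\<lambda>f. \<exists>i<n. \<forall>k. \<exists>r. f k = r \<and> g i k f = r)"
    by measurable
  then have "{f. \<exists>i<n. \<forall>k. \<exists>r. f k = r \<and> g i k f = r} \<in> sets baire"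
    by (simp only: pred_def space_borel UNIV_I simp_thms)
  moreover have "f \<in> guess_family n \<longleftrightarrow> (\<exists>i<n. \<forall>k. \<exists>r. f k = r \<and> g i k f = r)" for f
  proof
    assume "f \<in> guess_family n"
    then obtain p i where "i < n" "f = member n p i" unfolding guess_family_def by blast
    then show "\<exists>i<n. \<forall>k. \<exists>r. f k = r \<and> g i k f = r"
      by (auto simp: g_def decode_member)
  next
    assume "\<exists>i<n. \<forall>k. \<exists>r. f k = r \<and> g i k f = r"
    then obtain i where "i < n" "\<forall>k. f k = member n (decode f) i k" unfolding g_def by auto
    moreover from this have "f = member n (decode f) i" by blast
    ultimately show "f \<in> guess_family n" using member_in_guess_family by metis
  qed
  then have "guess_family n = {f. \<exists>i<n. \<forall>k. \<exists>r. f k = r \<and> g i k f = r}" by blast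
  ultimately show ?thesis by (simp only:)
qed

section \<open>Maximality and powers\<close>

text \<open>A family that is eventually different from \<open>h\<close> could be extended by \<open>h\<close>; infinity of \<open>A\<close>
  guarantees that \<open>h\<close> was not in the family already, as \<open>h\<close> agrees with itself on all of \<open>A\<close>.\<close>

lemma med_family_iff:
  assumes "infinite A"
  shows "med_family A B F \<longleftrightarrow>
    ed_family A B F \<and> (\<forall>h \<in> A \<rightarrow>\<^sub>E B. \<exists>f\<in>F. infinite (agreement A h f))"
proof
  assume med: "med_family A B F"
  have "\<exists>f\<in>F. infinite (agreement A h f)" if "h \<in> A \<rightarrow>\<^sub>E B" for h
  proof (rule ccontr)
    assume none: "\<not> ?thesis"
    moreover have "agreement A f h = agreement A h f" for f
      by (auto simp: agreement_def)
    ultimately have "ed_family A B (insert h F)"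
      using med that unfolding med_family_def ed_family_def pairwise_insert eventually_different_def
      by auto
    then have "h \<in> F" using med unfolding med_family_def by blast
    moreover have "agreement A h h = A" by (simp add: agreement_def)
    ultimately show False using none \<open>infinite A\<close> by metis
  qed
  with med show "ed_family A B F \<and> (\<forall>h \<in> A \<rightarrow>\<^sub>E B. \<exists>f\<in>F. infinite (agreement A h f))"
    unfolding med_family_def by blast
next
  assume *: "ed_family A B F \<and> (\<forall>h \<in> A \<rightarrow>\<^sub>E B. \<exists>f\<in>F. infinite (agreement A h f))"
  have "G \<subseteq> F" if G: "ed_family A B G" "F \<subseteq> G" for G
  proof
    fix h assume "h \<in> G"
    then obtain f where "f \<in> F" "infinite (agreement A h f)"
      using * G unfolding ed_family_def by blast
    then have "\<not> eventually_different A h f" by (simp add: eventually_different_def)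
    then have "h = f"
      using G \<open>h \<in> G\<close> \<open>f \<in> F\<close> unfolding ed_family_def pairwise_def by blast
    then show "h \<in> F" using \<open>f \<in> F\<close> by simp
  qed
  with * show "med_family A B F" unfolding med_family_def by blast
qed

text \<open>Different tuples of members differ in some coordinate, and the agreement of the products is
  contained in the agreement in that coordinate.\<close>

lemma ed_family_power:
  assumes "ed_family A B F"
  shows "ed_family A (tuples n B) (family_power A n F)"
proof -
  have "fun_product A fs \<in> A \<rightarrow>\<^sub>E tuples n B" if "fs \<in> tuples n F" for fs
  proof -
    have "f a \<in> B" if "f \<in> set fs" "a \<in> A" for f a
      using assms that \<open>fs \<in> tuples n F\<close> unfolding ed_family_def tuples_def by blast
    with that show ?thesis by (auto simp: tuples_def fun_product_def)
  qed
  moreover have "finite (agreement A (fun_product A fs) (fun_product A gs))"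
    if "fs \<in> tuples n F" "gs \<in> tuples n F" "fun_product A fs \<noteq> fun_product A gs" for fs gs
  proof -
    have len: "length fs = n" "length gs = n" using that by (auto simp: tuples_def)
    have "fs \<noteq> gs" using that by blast
    then obtain i where i: "i < n" "fs ! i \<noteq> gs ! i"
      by (metis len nth_equalityI)
    then have "fs ! i \<in> F" "gs ! i \<in> F" using that len by (auto simp: tuples_def)
    then have "finite (agreement A (fs ! i) (gs ! i))"
      using assms i unfolding ed_family_def pairwise_def eventually_different_def by blast
    moreover have "agreement A (fun_product A fs) (fun_product A gs) \<subseteq> agreement A (fs ! i) (gs ! i)"
    proof
      fix a assume "a \<in> agreement A (fun_product A fs) (fun_product A gs)"
      then have "a \<in> A" and maps: "map (\<lambda>f. f a) fs = map (\<lambda>f. f a) gs"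
        by (auto simp: agreement_def fun_product_def simp del: map_eq_conv)
      have "(fs ! i) a = map (\<lambda>f. f a) fs ! i" using i len by simp
      also have "\<dots> = map (\<lambda>f. f a) gs ! i" by (simp only: maps)
      also have "\<dots> = (gs ! i) a" using i len by simp
      finally show "a \<in> agreement A (fs ! i) (gs ! i)"
        using \<open>a \<in> A\<close> by (simp add: agreement_def)
    qed
    ultimately show ?thesis by (rule rev_finite_subset)
  qed
  ultimately show ?thesis
    unfolding ed_family_def family_power_def pairwise_def eventually_different_def by blast
qed

lemma med_family_power_iff:
  fixes F :: "('a \<Rightarrow> 'b) set"
  assumes "infinite (UNIV :: 'a set)" "ed_family UNIV UNIV F"
  shows "med_family UNIV (tuples n UNIV) (family_power UNIV n F) \<longleftrightarrow>
    (\<forall>h. \<exists>f. (\<forall>i<n. f i \<in> F) \<and> infinite {a. \<forall>i<n. f i a = h i a})"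
proof -
  have "med_family UNIV (tuples n UNIV) (family_power UNIV n F) \<longleftrightarrow>
      (\<forall>h \<in> UNIV \<rightarrow>\<^sub>E tuples n UNIV. \<exists>f \<in> family_power UNIV n F.
        infinite (agreement UNIV h f))"
    by (simp only: med_family_iff[OF assms(1)] ed_family_power[OF assms(2)] simp_thms)
  also have "\<dots> \<longleftrightarrow> (\<forall>h \<in> UNIV \<rightarrow>\<^sub>E tuples n UNIV. \<exists>fs \<in> tuples n F.
        infinite (agreement UNIV h (fun_product UNIV fs)))"
    by (simp only: family_power_def bex_simps)
  also have "\<dots> \<longleftrightarrow> (\<forall>h. \<exists>f. (\<forall>i<n. f i \<in> F) \<and> infinite {a. \<forall>i<n. f i a = h i a})"
    (is "?L \<longleftrightarrow> ?R")
  proof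
    assume L: ?L
    show ?R
    proof
      fix h :: "nat \<Rightarrow> 'a \<Rightarrow> 'b"
      have "(\<lambda>a. map (\<lambda>i. h i a) [0..<n]) \<in> UNIV \<rightarrow>\<^sub>E tuples n UNIV"
        by (auto simp: tuples_def)
      then obtain fs where fs: "fs \<in> tuples n F"
        "infinite (agreement UNIV (\<lambda>a. map (\<lambda>i. h i a) [0..<n]) (fun_product UNIV fs))"
        using L by blast
      have "agreement UNIV (\<lambda>a. map (\<lambda>i. h i a) [0..<n]) (fun_product UNIV fs)
          = {a. \<forall>i<n. (fs ! i) a = h i a}"
        using fs(1) by (auto simp: agreement_def fun_product_def tuples_def list_eq_iff_nth_eq)
      then show "\<exists>f. (\<forall>i<n. f i \<in> F) \<and> infinite {a. \<forall>i<n. f i a = h i a}"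
        using fs by (intro exI[of _ "nth fs"]) (auto simp: tuples_def)
    qed
  next
    assume R: ?R
    show ?L
    proof
      fix h :: "'a \<Rightarrow> 'b list" assume h: "h \<in> UNIV \<rightarrow>\<^sub>E tuples n UNIV"
      obtain f where f: "\<forall>i<n. f i \<in> F" "infinite {a. \<forall>i<n. f i a = h a ! i}"
        using R[rule_format, of "\<lambda>i a. h a ! i"] by blast
      have "length (h a) = n" for a using h by (auto simp: tuples_def PiE_def Pi_def)
      then have "agreement UNIV h (fun_product UNIV (map f [0..<n])) = {a. \<forall>i<n. f i a = h a ! i}"
        by (auto simp: agreement_def fun_product_def list_eq_iff_nth_eq)
      moreover have "map f [0..<n] \<in> tuples n F" using f(1) by (auto simp: tuples_def)
      ultimately show "\<exists>fs \<in> tuples n F. infinite (agreement UNIV h (fun_product UNIV fs))"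
        using f(2) by metis
    qed
  qed
  finally show ?thesis .
qed

lemma med_guess_family:
  assumes "n \<ge> 1"
  shows "med_family UNIV UNIV (guess_family n)"
proof -
  have "\<exists>f\<in>guess_family n. infinite {k. h k = f k}" for h
  proof -
    obtain f where f: "\<forall>i<n. f i \<in> guess_family n" "infinite {k. \<forall>i<n. f i k = h k}"
      using guess_family_hits[of n "\<lambda>i. h"] by blast
    have "{k. \<forall>i<n. f i k = h k} \<subseteq> {k. h k = f 0 k}" using assms by auto
    then have "infinite {k. h k = f 0 k}" using f(2) finite_subset by blast
    with f(1) assms show ?thesis by auto
  qed
  then show ?thesis
    by (simp add: med_family_iff ed_guess_family agreement_def)
qed

theorem theorem4p6:
  fixes n :: nat
  assumes "n \<ge> 1"
  shows "\<exists>\<E> :: (nat \<Rightarrow> nat) set.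
           \<E> \<in> sets borel \<and>
           med_family UNIV UNIV \<E> \<and>
           productive UNIV UNIV n \<E> \<and>
           \<not> productive UNIV UNIV (n + 1) \<E>"
proof (intro exI conjI)
  let ?E = "guess_family n"
  have power_iff: "med_family UNIV (tuples m UNIV) (family_power UNIV m ?E) \<longleftrightarrow>
      (\<forall>h. \<exists>f. (\<forall>i<m. f i \<in> ?E) \<and> infinite {k. \<forall>i<m. f i k = h i k})" for m
    by (rule med_family_power_iff[OF infinite_UNIV_nat ed_guess_family])
  show "?E \<in> sets borel" by (rule borel_guess_family)
  show med: "med_family UNIV UNIV ?E" by (rule med_guess_family[OF assms])
  show "productive UNIV UNIV n ?E"
    unfolding productive_def power_iff using med guess_family_hits[of n] by blast
  show "\<not> productive UNIV UNIV (n + 1) ?E"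
  proof
    assume "productive UNIV UNIV (n + 1) ?E"
    then obtain f where f: "\<forall>i<n + 1. f i \<in> ?E" "infinite {k. \<forall>i<n + 1. f i k = 2 * i}"
      unfolding productive_def power_iff by (elim conjE allE[of _ "\<lambda>i k. 2 * i"]) blast
    have "finite {k. \<forall>i\<le>n. f i k = 2 * i}"
      by (rule guess_family_avoids) (use f(1) in simp)
    then show False using f(2) by (simp add: less_Suc_eq_le)
  qed
qed

end
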